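(* Suppose $(S,T)$ is a $\lambda$-fold near-factorization of a finite group $G$ and $(S,T')$ is a $\lambda'$-fold near-factorization of the same group $G$. Then $\lambda=\lambda'$ and $T=T'$.
   Context: For subsets $S,T$ of a finite group $G$ with identity $e$, and a positive integer $\lambda$, $(S,T)$ is a $\lambda$-fold near-factorization of $G$ if $ST=\lambda(G-e)$ in the group ring $\mathbb{Z}[G]$, where subsets are identified with the sums of their elements. This means that every non-identity element $g\in G$ can be written as $g=xy$ with $x\in S$, $y\in T$ in exactly $\lambda$ ways, and $xy\neq e$ for all $x\in S$, $y\in T$.
   Formalization: The group G is assumed to be nontrivial; for the trivial group the claim fails, since G − e = 0 and S = T = ∅, T' = {e} satisfy both equations for all positive λ, λ'. *)

theory Defs
  imports "HOL-Algebra.Algebra"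
begin

text \<open>
  The integral group ring of \<open>G\<close>: finitely supported integer-valued functions on the carrier.
  Addition is that of the free Abelian group on the carrier; the product is the bilinear
  extension of the multiplication of \<open>G\<close>, where \<^term>\<open>frag_of x\<close> is the basis element belonging
  to \<open>x\<close> and \<^term>\<open>frag_extend f\<close> is the additive extension of \<open>f\<close> from basis elements.
\<close>

definition group_ring :: "('a, 'm) monoid_scheme \<Rightarrow> ('a \<Rightarrow>\<^sub>0 int) ring" where
  "group_ring G =
    \<lparr> carrier = {c. Poly_Mapping.keys c \<subseteq> carrier G},
      monoid.mult = (\<lambda>a b. frag_extend (\<lambda>x. frag_extend (\<lambda>y. frag_of (x \<otimes>\<^bsub>G\<^esub> y)) b) a),
      one = frag_of \<one>\<^bsub>G\<^esub>,
      ring.zero = 0,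
      ring.add = (+) \<rparr>"

definition set_elem :: "('a, 'm) monoid_scheme \<Rightarrow> 'a set \<Rightarrow> ('a \<Rightarrow>\<^sub>0 int)" where
  "set_elem G S = (\<Oplus>\<^bsub>group_ring G\<^esub>x\<in>S. frag_of x)"

definition near_factorization ::
  "('a, 'm) monoid_scheme \<Rightarrow> nat \<Rightarrow> 'a set \<Rightarrow> 'a set \<Rightarrow> bool" where
  "near_factorization G l S T \<longleftrightarrow>
     0 < l \<and> S \<subseteq> carrier G \<and> T \<subseteq> carrier G \<and>
     set_elem G S \<otimes>\<^bsub>group_ring G\<^esub> set_elem G T =
       [l] \<cdot>\<^bsub>group_ring G\<^esub> (set_elem G (carrier G) \<ominus>\<^bsub>group_ring G\<^esub> \<one>\<^bsub>group_ring G\<^esub>)"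

lemma group_ring_simps:
  "carrier (group_ring G) = {c. Poly_Mapping.keys c \<subseteq> carrier G}"
  "a \<otimes>\<^bsub>group_ring G\<^esub> b = frag_extend (\<lambda>x. frag_extend (\<lambda>y. frag_of (x \<otimes>\<^bsub>G\<^esub> y)) b) a"
  "\<one>\<^bsub>group_ring G\<^esub> = frag_of \<one>\<^bsub>G\<^esub>"
  "\<zero>\<^bsub>group_ring G\<^esub> = 0"
  "a \<oplus>\<^bsub>group_ring G\<^esub> b = a + b"
  by (simp_all add: group_ring_def)

lemma frag_extend_plus_fun:
  "frag_extend (\<lambda>x. f x + g x) c = frag_extend f c + frag_extend g c"
  by (simp add: frag_extend_def frag_cmul_distrib2 sum.distrib)

lemma frag_extend_diff_fun:
  "frag_extend (\<lambda>x. f x - g x) c = frag_extend f c - frag_extend g c"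
proof -
  have "frag_extend (\<lambda>x. f x - g x) c + frag_extend g c = frag_extend f c"
    by (simp flip: frag_extend_plus_fun)
  then show ?thesis by (simp add: eq_diff_eq)
qed

lemma frag_extend_frag_extend:
  "frag_extend f (frag_extend g c) = frag_extend (\<lambda>x. frag_extend f (g x)) c"
  using subset_UNIV
  by (induction c rule: frag_induction) (auto simp: frag_extend_diff)

lemma abelian_group_group_ring: "abelian_group (group_ring G)"
proof (rule abelian_groupI)
  fix x y assume "x \<in> carrier (group_ring G)" "y \<in> carrier (group_ring G)"
  then show "x \<oplus>\<^bsub>group_ring G\<^esub> y \<in> carrier (group_ring G)"
    using Poly_Mapping.keys_add[of x y] by (auto simp: group_ring_simps)
next
  fix x assume "x \<in> carrier (group_ring G)"
  then show "\<exists>y\<in>carrier (group_ring G). y \<oplus>\<^bsub>group_ring G\<^esub> x = \<zero>\<^bsub>group_ring G\<^esub>"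
    by (intro bexI[of _ "- x"]) (auto simp: group_ring_simps)
qed (auto simp: group_ring_simps algebra_simps)

lemma (in group) ring_group_ring: "ring (group_ring G)"
proof (rule ringI)
  show "abelian_group (group_ring G)" by (rule abelian_group_group_ring)
  show "monoid (group_ring G)"
  proof (rule monoidI)
    fix x y assume xy: "x \<in> carrier (group_ring G)" "y \<in> carrier (group_ring G)"
    have "Poly_Mapping.keys (frag_extend (\<lambda>x. frag_extend (\<lambda>y. frag_of (x \<otimes> y)) y) x)
      \<subseteq> (\<Union>u\<in>Poly_Mapping.keys x. \<Union>v\<in>Poly_Mapping.keys y. Poly_Mapping.keys (frag_of (u \<otimes> v)))"
      by (rule order_trans[OF keys_frag_extend]) (intro UN_mono order_refl keys_frag_extend)
    also have "\<dots> \<subseteq> carrier G" using xy by (auto simp: group_ring_simps)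
    finally show "x \<otimes>\<^bsub>group_ring G\<^esub> y \<in> carrier (group_ring G)"
      by (simp add: group_ring_simps)
  next
    show "\<one>\<^bsub>group_ring G\<^esub> \<in> carrier (group_ring G)" by (simp add: group_ring_simps)
  next
    fix x y z assume x: "x \<in> carrier (group_ring G)" and y: "y \<in> carrier (group_ring G)"
      and z: "z \<in> carrier (group_ring G)"
    have "u \<otimes> v \<otimes> w = u \<otimes> (v \<otimes> w)"
      if "u \<in> Poly_Mapping.keys x" "v \<in> Poly_Mapping.keys y" "w \<in> Poly_Mapping.keys z" for u v w
      using that x y z by (intro m_assoc) (auto simp: group_ring_simps)
    then show "x \<otimes>\<^bsub>group_ring G\<^esub> y \<otimes>\<^bsub>group_ring G\<^esub> z = x \<otimes>\<^bsub>group_ring G\<^esub> (y \<otimes>\<^bsub>group_ring G\<^esub> z)"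
      by (auto simp: group_ring_simps frag_extend_frag_extend intro!: frag_extend_eq)
  next
    fix x assume x: "x \<in> carrier (group_ring G)"
    have "frag_extend (\<lambda>y. frag_of (\<one> \<otimes> y)) x = frag_extend frag_of x"
      using x by (intro frag_extend_eq) (auto simp: group_ring_simps)
    then show "\<one>\<^bsub>group_ring G\<^esub> \<otimes>\<^bsub>group_ring G\<^esub> x = x"
      by (simp add: group_ring_simps flip: frag_expansion)
    have "frag_extend (\<lambda>y. frag_of (y \<otimes> \<one>)) x = frag_extend frag_of x"
      using x by (intro frag_extend_eq) (auto simp: group_ring_simps)
    then show "x \<otimes>\<^bsub>group_ring G\<^esub> \<one>\<^bsub>group_ring G\<^esub> = x"
      by (simp add: group_ring_simps flip: frag_expansion)
  qed
qed (simp_all add: group_ring_simps frag_extend_add frag_extend_plus_fun)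

lemma set_elem_eq_sum:
  assumes "finite S" "S \<subseteq> carrier G"
  shows "set_elem G S = (\<Sum>x\<in>S. frag_of x)"
proof -
  interpret abelian_group "group_ring G" by (rule abelian_group_group_ring)
  show ?thesis unfolding set_elem_def
    using assms
  proof (induction S rule: finite_induct)
    case (insert x F)
    then have "(\<lambda>x. frag_of x) \<in> F \<rightarrow> carrier (group_ring G)"
      "frag_of x \<in> carrier (group_ring G)"
      by (auto simp: group_ring_simps)
    with insert show ?case by (simp add: finsum_insert group_ring_simps(5))
  qed (simp add: group_ring_simps)
qed

lemma lookup_set_elem:
  assumes "finite S" "S \<subseteq> carrier G"
  shows "Poly_Mapping.lookup (set_elem G S) g = (if g \<in> S then 1 else 0)"
  using assms by (simp add: set_elem_eq_sum lookup_sum sum.delta')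

lemma (in group) group_ring_minus:
  assumes "x \<in> carrier (group_ring G)" "y \<in> carrier (group_ring G)"
  shows "x \<ominus>\<^bsub>group_ring G\<^esub> y = x - y"
proof -
  interpret R: ring "group_ring G" by (rule ring_group_ring)
  have "- y \<in> carrier (group_ring G)" "- y \<oplus>\<^bsub>group_ring G\<^esub> y = \<zero>\<^bsub>group_ring G\<^esub>"
    using assms by (auto simp: group_ring_simps)
  then have "\<ominus>\<^bsub>group_ring G\<^esub> y = - y" using assms R.minus_equality by blast
  then show ?thesis by (simp add: a_minus_def group_ring_simps)
qed

lemma group_ring_add_pow: "[l] \<cdot>\<^bsub>group_ring G\<^esub> x = frag_cmul (int l) x"
proof (induction l)
  case 0
  then show ?case by (simp add: add_pow_def group_ring_simps)
next
  case (Suc l)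
  then show ?case
    by (simp add: add_pow_def group_ring_simps frag_cmul_distrib algebra_simps)
qed

text \<open>The group-ring equation unfolds to the expected count of factorizations.\<close>

lemma (in group) near_factorization_iff_card:
  assumes fin: "finite (carrier G)"
  shows "near_factorization G l S T \<longleftrightarrow>
    0 < l \<and> S \<subseteq> carrier G \<and> T \<subseteq> carrier G \<and>
    (\<forall>x\<in>S. \<forall>y\<in>T. x \<otimes> y \<noteq> \<one>) \<and>
    (\<forall>g\<in>carrier G - {\<one>}. card {(x, y). x \<in> S \<and> y \<in> T \<and> g = x \<otimes> y} = l)"
proof (cases "S \<subseteq> carrier G \<and> T \<subseteq> carrier G")
  case True
  then have sub: "S \<subseteq> carrier G" "T \<subseteq> carrier G" by auto
  have finST: "finite S" "finite T" using sub fin finite_subset by blast+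
  define N where "N g = card {(x, y). x \<in> S \<and> y \<in> T \<and> g = x \<otimes> y}" for g
  have finN: "finite {(x, y). x \<in> S \<and> y \<in> T \<and> g = x \<otimes> y}" for g
    by (rule finite_subset[of _ "S \<times> T"]) (use finST in auto)
  have prod: "set_elem G S \<otimes>\<^bsub>group_ring G\<^esub> set_elem G T = (\<Sum>x\<in>S. \<Sum>y\<in>T. frag_of (x \<otimes> y))"
    using finST sub by (simp add: set_elem_eq_sum group_ring_simps frag_extend_sum o_def)
  have lhs: "Poly_Mapping.lookup (set_elem G S \<otimes>\<^bsub>group_ring G\<^esub> set_elem G T) g = int (N g)" for g
  proof -
    have "Poly_Mapping.lookup (set_elem G S \<otimes>\<^bsub>group_ring G\<^esub> set_elem G T) g
        = (\<Sum>z\<in>S \<times> T. if g = fst z \<otimes> snd z then 1 else 0)"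
      unfolding prod
      by (simp add: lookup_sum sum.cartesian_product case_prod_unfold eq_commute cong: sum.cong)
    also have "\<dots> = int (card {z \<in> S \<times> T. g = fst z \<otimes> snd z})"
      using finST by (simp flip: sum.inter_filter)
    also have "{z \<in> S \<times> T. g = fst z \<otimes> snd z} = {(x, y). x \<in> S \<and> y \<in> T \<and> g = x \<otimes> y}" by auto
    finally show ?thesis by (simp add: N_def)
  qed
  have carr: "set_elem G (carrier G) \<in> carrier (group_ring G)"
    using fin by (auto simp: group_ring_simps keys.rep_eq lookup_set_elem split: if_splits)
  have rhs: "Poly_Mapping.lookup ([l] \<cdot>\<^bsub>group_ring G\<^esub>
      (set_elem G (carrier G) \<ominus>\<^bsub>group_ring G\<^esub> \<one>\<^bsub>group_ring G\<^esub>)) g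
    = (if g \<in> carrier G - {\<one>} then int l else 0)" for g
    using fin carr
    by (auto simp: group_ring_add_pow group_ring_minus group_ring_simps lookup_minus lookup_set_elem)
  have out: "N g = 0" if "g \<notin> carrier G" for g
  proof -
    have "{(x, y). x \<in> S \<and> y \<in> T \<and> g = x \<otimes> y} = {}" using that sub by auto
    then show ?thesis by (simp only: N_def card.empty)
  qed
  have one: "N \<one> = 0 \<longleftrightarrow> (\<forall>x\<in>S. \<forall>y\<in>T. x \<otimes> y \<noteq> \<one>)"
    unfolding N_def card_0_eq[OF finN] by fastforce
  have "(set_elem G S \<otimes>\<^bsub>group_ring G\<^esub> set_elem G T =
       [l] \<cdot>\<^bsub>group_ring G\<^esub> (set_elem G (carrier G) \<ominus>\<^bsub>group_ring G\<^esub> \<one>\<^bsub>group_ring G\<^esub>)) \<longleftrightarrow>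
    (\<forall>g. int (N g) = (if g \<in> carrier G - {\<one>} then int l else 0))"
    unfolding poly_mapping_eq_iff fun_eq_iff lhs rhs ..
  also have "\<dots> \<longleftrightarrow> N \<one> = 0 \<and> (\<forall>g\<in>carrier G - {\<one>}. N g = l)"
    using out by (smt (verit) Diff_iff insertI1 one_closed singletonD of_nat_eq_iff of_nat_0)
  finally show ?thesis
    unfolding near_factorization_def using sub one by (simp add: N_def)
qed (auto simp: near_factorization_def)

end

theory Submission
  imports Defs
begin

text \<open>
  In \<open>\<rat>[G]\<close> the element \<open>G - e\<close> is invertible, because
  \<open>(G - e)(G - (n - 1)e) = (n - 1)e\<close> for \<open>n = |G| \<ge> 2\<close>. Hence \<open>ST = \<lambda>(G - e)\<close> makes left
  multiplication by \<open>S\<close> surjective, and therefore injective. To avoid linear algebra, injectivity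
  is obtained over \<open>\<int>/m\<close>, where it is the pigeonhole principle, for arbitrarily large \<open>m\<close>
  coprime to \<open>\<lambda>(n - 1)\<close>. Since \<open>S(\<lambda>'T) = S(\<lambda>T')\<close>, it follows that \<open>\<lambda>'T = \<lambda>T'\<close>, and comparing
  coefficients gives the claim.
\<close>

text \<open>The coefficients of the group ring product \<open>S f\<close>, for \<open>f\<close> given by its coefficients.\<close>

definition set_conv :: "('a, 'm) monoid_scheme \<Rightarrow> 'a set \<Rightarrow> ('a \<Rightarrow> int) \<Rightarrow> 'a \<Rightarrow> int" where
  "set_conv G S f g = (\<Sum>x\<in>S. f (inv\<^bsub>G\<^esub> x \<otimes>\<^bsub>G\<^esub> g))"

lemma set_conv_scale: "set_conv G S (\<lambda>x. c * f x) g = c * set_conv G S f g"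
  by (simp add: set_conv_def sum_distrib_left)

context group
begin

lemma set_conv_cong_mod:
  assumes "S \<subseteq> carrier G" "g \<in> carrier G" "\<And>x. x \<in> carrier G \<Longrightarrow> f x mod m = f' x mod m"
  shows "set_conv G S f g mod m = set_conv G S f' g mod m"
proof -
  have "(\<Sum>x\<in>S. f (inv x \<otimes> g) mod m) = (\<Sum>x\<in>S. f' (inv x \<otimes> g) mod m)"
    using assms by (intro sum.cong) auto
  then show ?thesis
    unfolding set_conv_def using mod_sum_eq[of "\<lambda>x. f (inv x \<otimes> g)" m S]
      mod_sum_eq[of "\<lambda>x. f' (inv x \<otimes> g)" m S] by argo
qed

text \<open>Since \<open>c\<close> is a unit modulo \<open>m\<close>, \<open>surj\<close> makes
  convolution with \<open>S\<close> surjective on functions from the group to the integers mod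
  \<open>m\<close>. There are finitely many of these, so it is injective.\<close>

lemma set_conv_cancel_mod:
  fixes c m :: int
  assumes fin: "finite (carrier G)" and S: "S \<subseteq> carrier G"
    and m: "0 < m" "coprime c m"
    and surj: "\<And>f. \<exists>h. \<forall>g\<in>carrier G. set_conv G S h g = c * f g"
    and eq: "\<And>g. g \<in> carrier G \<Longrightarrow> set_conv G S f g = set_conv G S f' g"
    and x: "x \<in> carrier G"
  shows "f x mod m = f' x mod m"
proof -
  \<comment> \<open>Functions into the integers mod \<open>m\<close> are represented by residues in
    \<open>{0..<m}\<close>, extensionally so that \<Omega> is finite; \<open>L\<close> is the map
    induced by convolution with \<open>S\<close>.\<close>
  define \<Omega> where "\<Omega> = carrier G \<rightarrow>\<^sub>E {0..<m}"
  define red where "red f = restrict (\<lambda>g. f g mod m) (carrier G)" for f :: "'a \<Rightarrow> int"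
  define L where "L f = red (set_conv G S f)" for f
  have red_mem: "red f \<in> \<Omega>" for f
    using m by (auto simp: red_def \<Omega>_def)
  have red_cong: "red f = red h \<longleftrightarrow> (\<forall>g\<in>carrier G. f g mod m = h g mod m)" for f h
    by (auto simp: red_def restrict_def fun_eq_iff)
  have L_red: "L (red f) = L f" for f
    unfolding L_def red_cong using S by (auto simp: red_def intro!: set_conv_cong_mod)
  obtain d e where d: "d * c + e * m = 1"
    using m(2) bezout_int[of c m] by auto
  have "\<Omega> \<subseteq> L ` \<Omega>"
  proof
    fix f assume f: "f \<in> \<Omega>"
    \<comment> \<open>By the Bezout relation \<open>d\<close> inverts \<open>c\<close> modulo
      \<open>m\<close>, so \<open>c * (d * f g)\<close> is congruent to \<open>f g\<close> and
      \<open>h\<close> is a preimage of \<open>f\<close>, up to reduction.\<close>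
    obtain h where h: "\<forall>g\<in>carrier G. set_conv G S h g = c * (d * f g)"
      using surj[of "\<lambda>g. d * f g"] by blast
    have "L h = red f"
      unfolding L_def red_cong
    proof
      fix g assume "g \<in> carrier G"
      moreover have "c * (d * f g) = (d * c + e * m) * f g - m * (e * f g)"
        by (simp add: algebra_simps)
      ultimately show "set_conv G S h g mod m = f g mod m"
        using h by (simp add: d mod_eq_dvd_iff)
    qed
    also have "red f = f"
    proof
      fix g show "red f g = f g"
        using f PiE_mem[of f "carrier G" "\<lambda>_. {0..<m}" g]
          PiE_arb[of f "carrier G" "\<lambda>_. {0..<m}" g]
        by (cases "g \<in> carrier G") (simp_all add: red_def \<Omega>_def)
    qed
    finally have "f = L (red h)" by (simp add: L_red)
    then show "f \<in> L ` \<Omega>" using red_mem by blast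
  qed
  moreover have "L ` \<Omega> \<subseteq> \<Omega>" using red_mem by (auto simp: L_def)
  moreover have "finite \<Omega>" using fin by (simp add: \<Omega>_def finite_PiE)
  \<comment> \<open>Pigeonhole: a surjection of a finite set onto itself is injective.\<close>
  ultimately have "inj_on L \<Omega>" by (metis eq_card_imp_inj_on subset_antisym)
  moreover have "L (red f) = L (red f')"
    unfolding L_red unfolding L_def red_cong using eq by simp
  ultimately have "red f = red f'"
    using red_mem by (auto dest: inj_onD)
  then show ?thesis using x by (simp add: red_cong)
qed

text \<open>Two integers congruent modulo some \<open>m\<close> larger than their distance are
  equal, so the modular version suffices.\<close>

lemma set_conv_cancel:
  fixes c :: int
  assumes fin: "finite (carrier G)" and S: "S \<subseteq> carrier G" and c: "0 < c"
    and surj: "\<And>f. \<exists>h. \<forall>g\<in>carrier G. set_conv G S h g = c * f g"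
    and eq: "\<And>g. g \<in> carrier G \<Longrightarrow> set_conv G S f g = set_conv G S f' g"
    and x: "x \<in> carrier G"
  shows "f x = f' x"
proof (rule ccontr)
  assume ne: "f x \<noteq> f' x"
  define k where "k = \<bar>f x - f' x\<bar>"
  \<comment> \<open>This is 1 modulo \<open>c\<close>, hence coprime to \<open>c\<close>, and it
    exceeds \<open>k\<close> because \<open>c\<close> is at least 1.\<close>
  define m where "m = 1 + k * c"
  have "k \<le> k * c" using c mult_left_mono[of 1 c k] by (simp add: k_def)
  then have m: "k < m" "0 < m" by (auto simp: m_def k_def)
  have "coprime c m"
    unfolding m_def coprime_iff_gcd_eq_1 using gcd_add_mult[of c k 1] by (simp add: add.commute)
  from set_conv_cancel_mod[OF fin S \<open>0 < m\<close> this surj eq x]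
  have "m dvd f x - f' x" by (simp add: mod_eq_dvd_iff)
  then have "m \<le> k" using ne zdvd_imp_le[of m k] by (simp add: k_def)
  with m show False by simp
qed

lemma set_conv_near_factorization:
  assumes fin: "finite (carrier G)" and nf: "near_factorization G l S T" and g: "g \<in> carrier G"
  shows "set_conv G S (set_conv G T f) g = int l * ((\<Sum>h\<in>carrier G. f h) - f g)"
proof -
  define N where "N h = {(x, y). x \<in> S \<and> y \<in> T \<and> h = x \<otimes> y}" for h
  have sub: "S \<subseteq> carrier G" "T \<subseteq> carrier G"
    and one: "\<forall>x\<in>S. \<forall>y\<in>T. x \<otimes> y \<noteq> \<one>"
    and N: "\<And>h. h \<in> carrier G - {\<one>} \<Longrightarrow> card (N h) = l"
    using nf unfolding near_factorization_iff_card[OF fin] N_def by blast+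
  have finST: "finite (S \<times> T)" using sub fin finite_subset by blast
  have "set_conv G S (set_conv G T f) g = (\<Sum>x\<in>S. \<Sum>y\<in>T. f (inv (x \<otimes> y) \<otimes> g))"
    unfolding set_conv_def
  proof (intro sum.cong refl)
    fix x y assume "x \<in> S" "y \<in> T"
    then have "x \<in> carrier G" "y \<in> carrier G" using sub by auto
    then show "f (inv y \<otimes> (inv x \<otimes> g)) = f (inv (x \<otimes> y) \<otimes> g)"
      using g by (simp add: inv_mult_group m_assoc)
  qed
  also have "\<dots> = (\<Sum>z\<in>S \<times> T. f (inv (fst z \<otimes> snd z) \<otimes> g))"
    by (simp add: sum.cartesian_product case_prod_unfold)
  \<comment> \<open>Pairs are grouped by their product \<open>h\<close>. No pair has product \<one>,
    so the fibres over the other elements exhaust \<open>S \<times> T\<close>, and each has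
    \<open>l\<close> members.\<close>
  also have "\<dots> = (\<Sum>h\<in>carrier G - {\<one>}. \<Sum>z\<in>{z \<in> S \<times> T. fst z \<otimes> snd z = h}.
      f (inv (fst z \<otimes> snd z) \<otimes> g))"
    using sub one fin finST by (intro sum.group[symmetric]) (auto intro!: m_closed dest: subsetD)
  also have "\<dots> = (\<Sum>h\<in>carrier G - {\<one>}. int l * f (inv h \<otimes> g))"
  proof (intro sum.cong refl)
    fix h assume h: "h \<in> carrier G - {\<one>}"
    have "{z \<in> S \<times> T. fst z \<otimes> snd z = h} = N h" by (auto simp: N_def)
    moreover have "(\<Sum>z\<in>N h. f (inv (fst z \<otimes> snd z) \<otimes> g)) = (\<Sum>z\<in>N h. f (inv h \<otimes> g))"
      by (intro sum.cong) (auto simp: N_def)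
    ultimately show "(\<Sum>z\<in>{z \<in> S \<times> T. fst z \<otimes> snd z = h}. f (inv (fst z \<otimes> snd z) \<otimes> g))
        = int l * f (inv h \<otimes> g)"
      using N[OF h] by simp
  qed
  also have "\<dots> = int l * ((\<Sum>h\<in>carrier G. f (inv h \<otimes> g)) - f g)"
    using fin g by (simp add: sum_diff1 flip: sum_distrib_left)
  also have "(\<Sum>h\<in>carrier G. f (inv h \<otimes> g)) = (\<Sum>h\<in>carrier G. f h)"
  proof (rule sum.reindex_bij_witness[where i = "\<lambda>h. g \<otimes> inv h" and j = "\<lambda>h. inv h \<otimes> g"])
    fix h assume h: "h \<in> carrier G"
    show "g \<otimes> inv (inv h \<otimes> g) = h" using g h by (simp add: inv_mult_group flip: m_assoc)
    show "inv (g \<otimes> inv h) \<otimes> g = h" using g h by (simp add: inv_mult_group m_assoc)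
  qed (use g in auto)
  finally show ?thesis .
qed

text \<open>The preceding lemma is applied to the indicator of the identity, whose convolution with
  \<open>T\<close> is the indicator of \<open>T\<close>.\<close>

lemma set_conv_near_factorization_indicator:
  assumes fin: "finite (carrier G)" and nf: "near_factorization G l S T" and g: "g \<in> carrier G"
  shows "set_conv G S (\<lambda>x. of_bool (x \<in> T)) g = int l * of_bool (g \<noteq> \<one>)"
proof -
  have sub: "S \<subseteq> carrier G" "T \<subseteq> carrier G" using nf by (auto simp: near_factorization_def)
  have finT: "finite T" using sub fin finite_subset by blast
  have T: "set_conv G T (\<lambda>x. of_bool (x = \<one>)) x = of_bool (x \<in> T)" if x: "x \<in> carrier G" for x
  proof -
    have "set_conv G T (\<lambda>x. of_bool (x = \<one>)) x = (\<Sum>y\<in>T. if y = x then 1 else 0)"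
      unfolding set_conv_def
    proof (intro sum.cong refl)
      fix y assume "y \<in> T"
      then have "y \<in> carrier G" using sub by auto
      then have "inv y \<otimes> x = \<one> \<longleftrightarrow> y = x" using x inv_solve_left'[of "\<one>" y x] by auto
      then show "of_bool (inv y \<otimes> x = \<one>) = (if y = x then 1 else 0 :: int)" by simp
    qed
    then show ?thesis using finT by simp
  qed
  have "set_conv G S (\<lambda>x. of_bool (x \<in> T)) g
      = set_conv G S (set_conv G T (\<lambda>x. of_bool (x = \<one>))) g"
    unfolding set_conv_def[of G S] using sub g by (intro sum.cong refl) (auto simp: T)
  also have "\<dots> = int l * of_bool (g \<noteq> \<one>)"
    using fin by (simp add: set_conv_near_factorization[OF fin nf g] of_bool_def)
  finally show ?thesis .
qed

lemma set_conv_cancel_near_factorization: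
  assumes fin: "finite (carrier G)" and nontriv: "carrier G \<noteq> {\<one>}"
    and nf: "near_factorization G l S T"
    and eq: "\<And>g. g \<in> carrier G \<Longrightarrow> set_conv G S f g = set_conv G S f' g"
    and x: "x \<in> carrier G"
  shows "f x = f' x"
proof -
  define n where "n = int (card (carrier G))"
  have "card (carrier G) \<noteq> 0" using fin by auto
  moreover have "card (carrier G) \<noteq> 1"
    using nontriv one_closed by (metis card_1_singletonE singletonD)
  ultimately have n: "1 < n" by (simp add: n_def)
  have l: "0 < l" and S: "S \<subseteq> carrier G" using nf by (auto simp: near_factorization_def)
  have "\<exists>h. \<forall>g\<in>carrier G. set_conv G S h g = int l * (n - 1) * f g" for f
  proof -
    define \<sigma> where "\<sigma> = (\<Sum>h\<in>carrier G. f h)"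
    \<comment> \<open>These are the coefficients of \<open>(G - (n - 1)e)f\<close>. Their sum is
      \<open>n * \<sigma> - (n - 1) * \<sigma> = \<sigma>\<close>, so applying \<open>T\<close> and
      then \<open>S\<close> gives \<open>l * (\<sigma> - f1 g) = l * (n - 1) * f g\<close>: the
      required preimage is \<open>set_conv G T f1\<close>.\<close>
    define f1 where "f1 x = \<sigma> - (n - 1) * f x" for x
    have "(\<Sum>h\<in>carrier G. f1 h) = \<sigma>"
      by (simp add: f1_def sum_subtractf flip: sum_distrib_left \<sigma>_def n_def) (simp add: algebra_simps)
    then have "set_conv G S (set_conv G T f1) g = int l * (n - 1) * f g" if "g \<in> carrier G" for g
      using set_conv_near_factorization[OF fin nf that, of f1] by (simp add: f1_def)
    then show ?thesis by blast
  qed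
  moreover have "0 < int l * (n - 1)" using l n by simp
  ultimately show ?thesis using set_conv_cancel[OF fin S _ _ eq x] by blast
qed

end

theorem theorem1p7:
  fixes G :: "('a, 'b) monoid_scheme" and l l' :: nat and S T T' :: "'a set"
  assumes "group G"
    and "finite (carrier G)"
    and "carrier G \<noteq> {\<one>\<^bsub>G\<^esub>}"
    and "near_factorization G l S T"
    and "near_factorization G l' S T'"
  shows "l = l' \<and> T = T'"
proof -
  interpret group G by fact
  have l: "0 < l" "0 < l'" and sub: "T \<subseteq> carrier G" "T' \<subseteq> carrier G"
    using assms(4,5) by (auto simp: near_factorization_def)
  \<comment> \<open>Both sides are the coefficients of \<open>l * l' * (G - e)\<close>.\<close>
  have "set_conv G S (\<lambda>x. int l' * of_bool (x \<in> T)) g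
      = set_conv G S (\<lambda>x. int l * of_bool (x \<in> T')) g" if "g \<in> carrier G" for g
    using that assms(2,4,5)
    by (simp add: set_conv_scale set_conv_near_factorization_indicator)
  then have eq: "int l' * of_bool (x \<in> T) = int l * of_bool (x \<in> T')" if "x \<in> carrier G" for x
    using set_conv_cancel_near_factorization[OF assms(2-4) _ that] by blast
  have "x \<in> T \<longleftrightarrow> x \<in> T'" if "x \<in> carrier G" for x
    using eq[OF that] l by (auto simp: of_bool_def split: if_splits)
  then have T: "T = T'" using sub by blast
  obtain g where g: "g \<in> carrier G" "g \<noteq> \<one>\<^bsub>G\<^esub>" using assms(3) one_closed by blast
  \<comment> \<open>At \<open>g\<close> the product with \<open>S\<close> has coefficient
    \<open>l > 0\<close>, whereas an empty \<open>T\<close> would give 0. A point of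
    \<open>T = T'\<close> is needed to read off \<open>l' = l\<close> from
    \<open>eq\<close>.\<close>
  have "T \<noteq> {}"
    using set_conv_near_factorization_indicator[OF assms(2,4) g(1)] g(2) l
    by (auto simp: set_conv_def)
  then obtain x where "x \<in> T" by blast
  then have "l = l'" using eq[of x] sub T by auto
  with T show ?thesis by simp
qed

end
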